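(* Let $\lambda>0$, let $\alpha:[0,\infty)\to(0,1)$ be a right-continuous piecewise constant function, and let $\{\xi^{\alpha(t)}(t)\}_{t\ge0}$, $\xi^{\alpha(t)}(t)=N(S^{\alpha(t)}(t))$, be the generalized space-fractional Poisson process via variable-order stable subordinator with rate $\lambda$ and index $\alpha(\cdot)$. Let $t>0$ and let $0=t_0<t_1<\cdots<t_n=t$ be a partition of $[0,t]$ such that $\alpha(s)=\alpha_k$ for all $s\in[t_{k-1},t_k)$, $k=1,\ldots,n$, with constants $\alpha_k\in(0,1)$. Then for every integer $m\ge0$, $$\mathbb{P}[\xi^{\alpha(t)}(t)=m]=\frac{(-1)^m}{m!}\sum_{r=0}^\infty\frac{(-1)^r}{r!}\sum_{\substack{x_1,\ldots,x_n\ge0\\ x_1+\cdots+x_n=r}}\frac{r!}{x_1!\,x_2!\cdots x_n!}\,\lambda^{\sum_{i=1}^n\alpha_ix_i}\,(\alpha_1x_1+\cdots+\alpha_nx_n)_m\prod_{k=1}^n(t_k-t_{k-1})^{x_k},$$ where the inner sum runs over nonnegative integers $x_1,\ldots,x_n$ and $(a)_m=a(a-1)\cdots(a-m+1)$, $(a)_0=1$, denotes the falling factorial.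
   Context: Piecewise constant index: $\alpha:[0,\infty)\to(0,1)$ is right-continuous and piecewise constant, with finitely many pieces on every bounded interval. That is, there are breakpoints $0=s_0<s_1<s_2<\cdots$ (either finitely many, with the last interval extending to $\infty$, or infinitely many with $s_j\to\infty$) and constants $\beta_j\in(0,1)$ such that $\alpha(t)=\beta_j$ for all $t\in[s_{j-1},s_j)$. Classical stable subordinator: for $a\in(0,1)$, an $a$-stable subordinator $\{S^{a}(t)\}_{t\ge0}$ is a nondecreasing Lévy process started at $0$ with $\mathbb{E}[e^{-w S^{a}(t)}]=e^{-t w^{a}}$ for all $t\ge0$, $w\ge0$. Variable-order stable subordinator (VOSS) with index $\alpha(\cdot)$: take independent classical stable subordinators $S^{\beta_1},S^{\beta_2},\ldots$, one for each interval $[s_{j-1},s_j)$, the $j$-th having index $\beta_j$ (subordinators attached to different intervals are independent even if their indices coincide). For $t\ge0$ let $k$ be such that $s_{k-1}\le t<s_k$ (with $s_k=\infty$ if the $k$-th interval is the last one). Then $$S^{\alpha(t)}(t)=\sum_{j=1}^{k-1}S^{\beta_j}(s_j-s_{j-1})+S^{\beta_k}(t-s_{k-1}).$$ Generalized space-fractional Poisson process via variable-order stable subordinator: $\xi^{\alpha(t)}(t)=N(S^{\alpha(t)}(t))$, $t\ge0$, where $\{N(t)\}_{t\ge0}=\{N(t,\lambda)\}_{t\ge0}$ is a homogeneous Poisson process with rate $\lambda>0$ independent of the VOSS $\{S^{\alpha(t)}(t)\}_{t\ge0}$. *)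

theory Defs
  imports "HOL-Probability.Probability"
begin

definition falling_factorial :: "real \<Rightarrow> nat \<Rightarrow> real" where
  "falling_factorial a m = (\<Prod>i<m. a - real i)"

subsection \<open>Processes\<close>

text \<open>
  Processes are indexed by the reals, but only their values at times \<open>t \<ge> 0\<close> matter. Path properties
  are required almost surely, as usual.
\<close>

definition levy_process :: "'a measure \<Rightarrow> (real \<Rightarrow> 'a \<Rightarrow> real) \<Rightarrow> bool" where
  "levy_process M X \<longleftrightarrow>
     prob_space M \<and>
     (\<forall>t\<ge>0. X t \<in> borel_measurable M) \<and>
     (AE \<omega> in M. X 0 \<omega> = 0) \<and>
     (\<forall>n t. 0 \<le> t 0 \<longrightarrow> (\<forall>i<n. t i < t (Suc i)) \<longrightarrow>
        prob_space.indep_vars M (\<lambda>_. borel) (\<lambda>i \<omega>. X (t (Suc i)) \<omega> - X (t i) \<omega>) {..<n}) \<and>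
     (\<forall>t\<ge>0. \<forall>h\<ge>0. distr M borel (\<lambda>\<omega>. X (t + h) \<omega> - X t \<omega>) = distr M borel (X h)) \<and>
     (\<forall>t\<ge>0. \<forall>\<epsilon>>0.
        ((\<lambda>u. measure M {\<omega> \<in> space M. \<bar>X u \<omega> - X t \<omega>\<bar> > \<epsilon>}) \<longlongrightarrow> 0) (at t within {0..})) \<and>
     (AE \<omega> in M. (\<forall>t\<ge>0. ((\<lambda>u. X u \<omega>) \<longlongrightarrow> X t \<omega>) (at_right t)) \<and>
                  (\<forall>t>0. \<exists>l. ((\<lambda>u. X u \<omega>) \<longlongrightarrow> l) (at_left t)))"

definition stable_subordinator :: "'a measure \<Rightarrow> real \<Rightarrow> (real \<Rightarrow> 'a \<Rightarrow> real) \<Rightarrow> bool" where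
  "stable_subordinator M a S \<longleftrightarrow>
     levy_process M S \<and>
     (AE \<omega> in M. mono_on {0..} (\<lambda>t. S t \<omega>)) \<and>
     (\<forall>t\<ge>0. \<forall>w\<ge>0. (\<integral>\<omega>. exp (- w * S t \<omega>) \<partial>M) = exp (- t * w powr a))"

text \<open>Time 0 is covered by \<open>levy_process\<close>; \<open>poisson_pmf\<close> is specified for positive rates only.\<close>

definition poisson_process :: "'a measure \<Rightarrow> real \<Rightarrow> (real \<Rightarrow> 'a \<Rightarrow> nat) \<Rightarrow> bool" where
  "poisson_process M rate N \<longleftrightarrow>
     levy_process M (\<lambda>t \<omega>. real (N t \<omega>)) \<and>
     (\<forall>t>0. distr M (count_space UNIV) (N t) = measure_pmf (poisson_pmf (rate * t)))"

text \<open>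
  The process as a single random element of the product space over \<open>[0, \<infinity>)\<close>; independence of
  processes is independence of these random elements. Since \<open>prob_space.indep_var\<close> takes two random
  elements of the same type, a counting process is embedded into the reals pointwise, which
  generates the same \<open>\<sigma>\<close>-algebra.
\<close>

definition whole_path :: "(real \<Rightarrow> 'a \<Rightarrow> 'b) \<Rightarrow> 'a \<Rightarrow> real \<Rightarrow> 'b" where
  "whole_path X = (\<lambda>\<omega>. \<lambda>t\<in>{0..}. X t \<omega>)"

subsection \<open>Variable-order stable subordinators\<close>

text \<open>
  \<open>K\<close> is the (possibly infinite) number of pieces. Pieces are numbered from 0: piece \<open>j\<close> is
  \<open>[s j, s (j+1))\<close>, except that the last piece, if there is one, is \<open>[s j, \<infinity>)\<close>. Values
  \<open>s j\<close> with \<open>j \<ge> K\<close> are irrelevant.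
\<close>

definition breakpoints :: "enat \<Rightarrow> (nat \<Rightarrow> real) \<Rightarrow> bool" where
  "breakpoints K s \<longleftrightarrow>
     0 < K \<and> s 0 = 0 \<and> (\<forall>j. enat (Suc j) < K \<longrightarrow> s j < s (Suc j)) \<and>
     (K = \<infinity> \<longrightarrow> filterlim s at_top sequentially)"

definition piece :: "enat \<Rightarrow> (nat \<Rightarrow> real) \<Rightarrow> nat \<Rightarrow> real set" where
  "piece K s j = (if enat (Suc j) < K then {s j..<s (Suc j)} else {s j..})"

definition piecewise_constant_index ::
  "(real \<Rightarrow> real) \<Rightarrow> enat \<Rightarrow> (nat \<Rightarrow> real) \<Rightarrow> (nat \<Rightarrow> real) \<Rightarrow> bool" where
  "piecewise_constant_index \<alpha> K s \<beta> \<longleftrightarrow>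
     breakpoints K s \<and>
     (\<forall>j. enat j < K \<longrightarrow> 0 < \<beta> j \<and> \<beta> j < 1 \<and> (\<forall>t\<in>piece K s j. \<alpha> t = \<beta> j))"

definition piece_index :: "enat \<Rightarrow> (nat \<Rightarrow> real) \<Rightarrow> real \<Rightarrow> nat" where
  "piece_index K s t = (THE k. enat k < K \<and> t \<in> piece K s k)"

definition independent_stable_subordinators ::
  "'a measure \<Rightarrow> enat \<Rightarrow> (nat \<Rightarrow> real) \<Rightarrow> (nat \<Rightarrow> real \<Rightarrow> 'a \<Rightarrow> real) \<Rightarrow> bool" where
  "independent_stable_subordinators M K \<beta> S \<longleftrightarrow>
     (\<forall>j. enat j < K \<longrightarrow> stable_subordinator M (\<beta> j) (S j)) \<and>
     prob_space.indep_vars M (\<lambda>_. \<Pi>\<^sub>M t\<in>{0..}. borel) (\<lambda>j. whole_path (S j)) {j. enat j < K}"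

definition voss ::
  "enat \<Rightarrow> (nat \<Rightarrow> real) \<Rightarrow> (nat \<Rightarrow> real \<Rightarrow> 'a \<Rightarrow> real) \<Rightarrow> real \<Rightarrow> 'a \<Rightarrow> real" where
  "voss K s S t \<omega> =
     (let k = piece_index K s t
      in (\<Sum>j<k. S j (s (Suc j) - s j) \<omega>) + S k (t - s k) \<omega>)"

definition space_fractional_poisson_voss ::
  "(real \<Rightarrow> 'a \<Rightarrow> nat) \<Rightarrow> enat \<Rightarrow> (nat \<Rightarrow> real) \<Rightarrow> (nat \<Rightarrow> real \<Rightarrow> 'a \<Rightarrow> real)
     \<Rightarrow> real \<Rightarrow> 'a \<Rightarrow> nat" where
  "space_fractional_poisson_voss N K s S t \<omega> = N (voss K s S t \<omega>) \<omega>"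

text \<open>
  As path properties hold only almost surely, \<open>\<omega> \<mapsto> N (voss K s S t \<omega>) \<omega>\<close> need not be measurable with
  respect to \<open>M\<close>, only up to null sets. Probabilities of events concerning it are therefore taken
  in the completion of \<open>M\<close>, which agrees with \<open>M\<close> on \<open>sets M\<close>.
\<close>

end

theory Submission
  imports Defs
begin

text \<open>
  Put \<open>V = voss K s S t\<close>. Since \<open>N\<close> is independent of \<open>V\<close>, the variable \<open>N V\<close> is Poisson with random
  parameter \<open>rate * V\<close> (\<open>prob_poisson_at_independent_time\<close>), so its generating function at \<open>u\<close> is
  the Laplace transform of \<open>V\<close> at \<open>rate * (1 - u)\<close> (\<open>poisson_mixture_generating_function\<close>).

  The Laplace transform of \<open>V\<close> is a product of stable ones, \<open>w \<mapsto> exp (- \<psi> w)\<close> with \<open>\<psi> w\<close> the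
  integral of \<open>w powr \<alpha> u\<close> over \<open>{0..t}\<close> (\<open>voss_laplace_transform\<close>). Written as an integral, the
  exponent can be computed with the given partition as well as with the breakpoints that define
  the process, which gives \<open>\<psi> w = (\<Sum>k=1..n. (\<tau> k - \<tau> (k - 1)) * w powr a k)\<close>.

  It remains to find the coefficient of \<open>u ^ m\<close> in \<open>exp (- \<psi> (rate * (1 - u)))\<close>. Expanding by the
  exponential series, the multinomial theorem and the binomial series
  \<open>(1 - u) powr e = (\<Sum>m. (e gchoose m) * (- u) ^ m)\<close> produces exactly the terms of the theorem, the
  falling factorial being \<open>fact m * (e gchoose m)\<close>. The rearrangement is justified because the same
  expansion with absolute values converges (\<open>exp_series_expansion\<close>). Comparing coefficients takes
  the place of differentiating the Laplace transform \<open>m\<close> times.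
\<close>

section \<open>Power series of exponentials of sums of powers\<close>

text \<open>
  The multinomial theorem with every power divided by its factorial. In this normalisation adding
  one summand is a Cauchy product, so induction on the index set reduces the claim to the
  addition law of the exponential series.
\<close>
lemma sum_power_div_fact:
  fixes y :: "'i \<Rightarrow> real"
  assumes "finite A"
  shows "(\<Sum>i\<in>A. y i) ^ r / fact r =
      (\<Sum>x | x \<in> A \<rightarrow>\<^sub>E (UNIV :: nat set) \<and> sum x A = r. \<Prod>i\<in>A. y i ^ x i / fact (x i))"
proof -
  have fin: "finite {x \<in> A \<rightarrow>\<^sub>E (UNIV :: nat set). sum x A = r}" if "finite A" for A :: "'i set" and r
  proof (rule finite_subset)
    show "{x \<in> A \<rightarrow>\<^sub>E (UNIV :: nat set). sum x A = r} \<subseteq> A \<rightarrow>\<^sub>E {..r}"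
      using that by (auto simp: PiE_iff extensional_def intro: member_le_sum)
    show "finite (A \<rightarrow>\<^sub>E {..r})" using that by (intro finite_PiE) auto
  qed
  show "(\<Sum>i\<in>A. y i) ^ r / fact r =
      (\<Sum>x | x \<in> A \<rightarrow>\<^sub>E (UNIV :: nat set) \<and> sum x A = r. \<Prod>i\<in>A. y i ^ x i / fact (x i))"
    using assms
  proof (induction A arbitrary: r rule: finite_induct)
    case empty
    then show ?case by (cases "r = 0") auto
  next
    case (insert b A)
    let ?P = "\<lambda>A r. {x \<in> A \<rightarrow>\<^sub>E (UNIV :: nat set). sum x A = r}"
    have "(\<Sum>i\<in>insert b A. y i) ^ r / fact r =
        (\<Sum>k\<le>r. y b ^ k / fact k * ((\<Sum>i\<in>A. y i) ^ (r - k) / fact (r - k)))"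
      using insert.hyps exp_series_add_commuting[of "y b" "\<Sum>i\<in>A. y i" r]
      by (simp add: mult.commute divide_inverse)
    also have "\<dots> = (\<Sum>k\<le>r. \<Sum>x\<in>?P A (r - k). y b ^ k / fact k * (\<Prod>i\<in>A. y i ^ x i / fact (x i)))"
      by (simp add: insert.IH sum_distrib_left)
    also have "\<dots> = (\<Sum>(k, x)\<in>(SIGMA k:{..r}. ?P A (r - k)).
        y b ^ k / fact k * (\<Prod>i\<in>A. y i ^ x i / fact (x i)))"
      using fin[OF insert.hyps(1)] by (subst sum.Sigma) auto
    also have "\<dots> = (\<Sum>x\<in>?P (insert b A) r. \<Prod>i\<in>insert b A. y i ^ x i / fact (x i))"
    \<comment> \<open>Split an index function into its value at the new index and its restriction to the old
      ones; extensionality forces the value \<open>undefined\<close> at the removed index.\<close>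
    proof (rule sum.reindex_bij_witness[of _ "\<lambda>x. (x b, x(b := undefined))" "\<lambda>(k, x). x(b := k)"], goal_cases)
      case (1 p)
      then show ?case using insert.hyps by (auto simp: PiE_iff extensional_def fun_eq_iff)
    next
      case (2 p)
      then obtain k x where p: "p = (k, x)" "k \<le> r" "x \<in> ?P A (r - k)" by auto
      have "sum (x(b := k)) A = sum x A" using insert.hyps by (intro sum.cong) auto
      with p show ?case using insert.hyps by (auto simp: PiE_iff extensional_def)
    next
      case (3 x)
      then show ?case by auto
    next
      case (4 x)
      have "sum (x(b := undefined)) A = sum x A" using insert.hyps by (intro sum.cong) auto
      with 4 show ?case using insert.hyps by (auto simp: PiE_iff extensional_def)
    next
      case (5 p)
      then obtain k x where p: "p = (k, x)" by fastforce
      have "(\<Prod>i\<in>A. y i ^ (x(b := k)) i / fact ((x(b := k)) i)) = (\<Prod>i\<in>A. y i ^ x i / fact (x i))"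
        using insert.hyps by (intro prod.cong) auto
      then show ?case using insert.hyps p by simp
    qed
    finally show ?case .
  qed
qed

lemma sum_powr_power_multinomial:
  fixes d a :: "'i \<Rightarrow> real"
  assumes "finite A" "0 < w"
  shows "(\<Sum>i\<in>A. d i * w powr a i) ^ r =
    (\<Sum>x | x \<in> A \<rightarrow>\<^sub>E (UNIV :: nat set) \<and> sum x A = r.
       fact r / (\<Prod>i\<in>A. fact (x i)) * w powr (\<Sum>i\<in>A. a i * real (x i)) * (\<Prod>i\<in>A. d i ^ x i))"
proof -
  have "(\<Prod>i\<in>A. (d i * w powr a i) ^ x i / fact (x i)) =
      w powr (\<Sum>i\<in>A. a i * real (x i)) * (\<Prod>i\<in>A. d i ^ x i) / (\<Prod>i\<in>A. fact (x i))"
    for x :: "'i \<Rightarrow> nat"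
    using assms by (simp add: powr_sum power_mult_distrib prod_dividef prod.distrib powr_powr
      flip: powr_realpow)
  then show ?thesis
    using sum_power_div_fact[OF assms(1), of "\<lambda>i. d i * w powr a i" r]
    by (simp add: field_simps sum_distrib_left)
qed

lemma gbinomial_eq_falling_factorial: "A gchoose m = falling_factorial A m / fact m"
  by (simp add: gbinomial_prod_rev falling_factorial_def lessThan_atLeast0)

text \<open>
  Passing to exponent \<open>- A\<close> makes all factors of the numerator have the same sign, which only
  increases their absolute values. Hence \<open>(1 - v) powr (- A)\<close> is a majorant of the binomial
  series of exponent \<open>A\<close>.
\<close>
lemma abs_gbinomial_le:
  fixes A :: real
  assumes "0 \<le> A"
  shows "\<bar>A gchoose m\<bar> \<le> (-1) ^ m * (- A gchoose m)"
proof -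
  have "\<bar>\<Prod>i = 0..<m. A - real i\<bar> \<le> (\<Prod>i = 0..<m. A + real i)"
    unfolding abs_prod using assms by (intro prod_mono) auto
  also have "\<dots> = (-1) ^ m * (\<Prod>i = 0..<m. - A - real i)"
    by (induction m) (auto simp: algebra_simps)
  finally show ?thesis
    by (simp add: gbinomial_prod_rev divide_right_mono)
qed

lemma abs_gbinomial_series:
  fixes A u :: real
  assumes "0 \<le> A" "\<bar>u\<bar> < 1"
  shows "summable (\<lambda>m. \<bar>(A gchoose m) * u ^ m\<bar>)"
    and "(\<Sum>m. \<bar>(A gchoose m) * u ^ m\<bar>) \<le> (1 - \<bar>u\<bar>) powr (- A)"
proof -
  have S: "(\<lambda>m. (- A gchoose m) * (- \<bar>u\<bar>) ^ m) sums (1 - \<bar>u\<bar>) powr (- A)"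
    using gen_binomial_real[of "- \<bar>u\<bar>" "- A"] assms by simp
  have le: "\<bar>(A gchoose m) * u ^ m\<bar> \<le> (- A gchoose m) * (- \<bar>u\<bar>) ^ m" for m
    using mult_right_mono[OF abs_gbinomial_le[OF assms(1), of m], of "\<bar>u\<bar> ^ m"]
    by (simp add: abs_mult power_abs power_minus[of "\<bar>u\<bar>"] mult_ac)
  show s: "summable (\<lambda>m. \<bar>(A gchoose m) * u ^ m\<bar>)"
    by (rule summable_comparison_test[OF _ sums_summable[OF S]]) (use le in auto)
  show "(\<Sum>m. \<bar>(A gchoose m) * u ^ m\<bar>) \<le> (1 - \<bar>u\<bar>) powr (- A)"
    using suminf_le[OF le s sums_summable[OF S]] sums_unique[OF S] by simp
qed

text \<open>
  Fubini for double series, with absolute summability of the whole family given by a summable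
  bound on the row sums.
\<close>
lemma sums_swap:
  fixes F :: "nat \<Rightarrow> nat \<Rightarrow> real"
  assumes abs: "\<And>r. summable (\<lambda>m. \<bar>F m r\<bar>)"
    and bnd: "\<And>r. (\<Sum>m. \<bar>F m r\<bar>) \<le> B r" and "summable B"
  shows "summable (\<lambda>r. F m r)"
    and "(\<lambda>m. \<Sum>r. F m r) sums (\<Sum>r. \<Sum>m. F m r)"
proof -
  have hs: "((\<lambda>m. \<bar>F m r\<bar>) has_sum (\<Sum>m. \<bar>F m r\<bar>)) UNIV" for r
    by (intro sums_nonneg_imp_has_sum summable_sums abs) auto
  have "summable (\<lambda>r. \<Sum>m. \<bar>F m r\<bar>)"
    by (rule summable_comparison_test[OF _ \<open>summable B\<close>]) (use bnd suminf_nonneg[OF abs] in auto)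
  then have "(\<lambda>r. \<Sum>m. \<bar>F m r\<bar>) summable_on UNIV"
    using suminf_nonneg[OF abs] by (intro summable_nonneg_imp_summable_on) auto
  then have "(\<lambda>(r, m). \<bar>F m r\<bar>) summable_on (UNIV \<times> UNIV)"
    using hs by (intro summable_on_SigmaI[where g = "\<lambda>r. \<Sum>m. \<bar>F m r\<bar>"]) auto
  then have rm: "(\<lambda>(r, m). F m r) summable_on (UNIV \<times> UNIV)"
    using abs_summable_summable[of "\<lambda>p. F (snd p) (fst p)" "UNIV \<times> UNIV"]
    by (simp add: case_prod_unfold)
  then have mr: "(\<lambda>(m, r). F m r) summable_on (UNIV \<times> UNIV)"
    using summable_on_swap[of "\<lambda>(r, m). F m r" UNIV UNIV] by simp
  have r1: "(\<lambda>r. F m r) summable_on UNIV" for m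
    using summable_on_SigmaD1[OF mr] by blast
  show "summable (\<lambda>r. F m r)" by (rule summable_on_imp_summable[OF r1])
  have c1: "(\<Sum>\<^sub>\<infinity>r. F m r) = (\<Sum>r. F m r)" for m
    using has_sum_imp_sums[OF has_sum_infsum[OF r1]] sums_unique by blast
  have r2: "(\<lambda>m. F m r) summable_on UNIV" for r
    using summable_on_SigmaD1[OF rm] by blast
  have c2: "(\<Sum>\<^sub>\<infinity>m. F m r) = (\<Sum>m. F m r)" for r
    using has_sum_imp_sums[OF has_sum_infsum[OF r2]] sums_unique by blast
  have s1: "(\<lambda>m. \<Sum>\<^sub>\<infinity>r. F m r) summable_on UNIV"
    using summable_on_Sigma_banach[OF mr] by simp
  have s2: "(\<lambda>r. \<Sum>\<^sub>\<infinity>m. F m r) summable_on UNIV"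
    using summable_on_Sigma_banach[OF rm] by simp
  have "(\<Sum>\<^sub>\<infinity>m. \<Sum>\<^sub>\<infinity>r. F m r) = (\<Sum>\<^sub>\<infinity>r. \<Sum>\<^sub>\<infinity>m. F m r)"
    using infsum_swap_banach[OF mr] .
  then have "((\<lambda>m. \<Sum>\<^sub>\<infinity>r. F m r) has_sum (\<Sum>\<^sub>\<infinity>r. \<Sum>\<^sub>\<infinity>m. F m r)) UNIV"
    using has_sum_infsum[OF s1] by simp
  moreover have "(\<Sum>\<^sub>\<infinity>r. \<Sum>\<^sub>\<infinity>m. F m r) = (\<Sum>r. \<Sum>m. F m r)"
    using has_sum_imp_sums[OF has_sum_infsum[OF s2]] sums_unique by (auto simp: c2)
  ultimately show "(\<lambda>m. \<Sum>r. F m r) sums (\<Sum>r. \<Sum>m. F m r)"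
    using has_sum_imp_sums by (auto simp: c1)
qed

text \<open>
  The summand of order \<open>r\<close> in the series of the theorem, over an arbitrary index set of pieces with
  exponents \<open>a\<close> and lengths \<open>d\<close>.
\<close>
definition expansion_term ::
  "real \<Rightarrow> 'i set \<Rightarrow> ('i \<Rightarrow> real) \<Rightarrow> ('i \<Rightarrow> real) \<Rightarrow> nat \<Rightarrow> nat \<Rightarrow> real" where
  "expansion_term \<mu> A a d m r = (-1) ^ r / fact r *
     (\<Sum>x | x \<in> A \<rightarrow>\<^sub>E (UNIV :: nat set) \<and> sum x A = r.
        fact r / (\<Prod>i\<in>A. fact (x i)) * \<mu> powr (\<Sum>i\<in>A. a i * real (x i)) *
        falling_factorial (\<Sum>i\<in>A. a i * real (x i)) m * (\<Prod>i\<in>A. d i ^ x i))"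

text \<open>
  Let \<open>\<psi> w = (\<Sum>i\<in>A. d i * w powr a i)\<close>. Expand \<open>exp (- \<psi> (\<mu> * (1 - u)))\<close> first by the exponential
  series, then \<open>\<psi> (\<mu> * (1 - u)) ^ r\<close> by the multinomial theorem, and finally each
  \<open>(1 - u) powr e\<close> by the binomial series. Every step taken with absolute values gives at most
  the expansion of \<open>exp (\<psi> (\<mu> / (1 - \<bar>u\<bar>)))\<close>, so the terms may be reordered and collected by powers
  of \<open>u\<close>. Summability for a fixed \<open>m\<close> is read off from the collected family by dividing by
  \<open>u ^ m\<close>; this is why \<open>u\<close> is kept away from \<open>0\<close>, and a punctured neighbourhood still determines
  the coefficients.
\<close>
lemma exp_series_expansion:
  fixes a d :: "'i \<Rightarrow> real"
  assumes "finite A" "0 < \<mu>" "\<And>i. i \<in> A \<Longrightarrow> 0 \<le> a i" "\<And>i. i \<in> A \<Longrightarrow> 0 \<le> d i" "\<bar>u\<bar> < 1" "u \<noteq> 0"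
  shows "summable (expansion_term \<mu> A a d m)"
    and "(\<lambda>m. ((-1) ^ m / fact m * (\<Sum>r. expansion_term \<mu> A a d m r)) * u ^ m)
           sums exp (- (\<Sum>i\<in>A. d i * (\<mu> * (1 - u)) powr a i))"
proof -
  define P where "P r = {x. x \<in> A \<rightarrow>\<^sub>E (UNIV :: nat set) \<and> sum x A = r}" for r
  define e where "e x = (\<Sum>i\<in>A. a i * real (x i))" for x :: "'i \<Rightarrow> nat"
  define c where "c r x = fact r / (\<Prod>i\<in>A. fact (x i)) * (\<Prod>i\<in>A. d i ^ x i)" for r and x :: "'i \<Rightarrow> nat"
  define \<psi> where "\<psi> w = (\<Sum>i\<in>A. d i * w powr a i)" for w
  define F where "F m r = (-1) ^ m / fact m * expansion_term \<mu> A a d m r * u ^ m" for m r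
  have multi: "\<psi> w ^ r = (\<Sum>x\<in>P r. c r x * w powr e x)" if "0 < w" for w r
    using sum_powr_power_multinomial[OF assms(1) that, of d a r]
    by (simp add: \<psi>_def P_def c_def e_def mult_ac)
  have e0: "0 \<le> e x" for x unfolding e_def using assms by (intro sum_nonneg) auto
  have c0: "0 \<le> c r x" for r x unfolding c_def using assms
    by (intro mult_nonneg_nonneg divide_nonneg_nonneg prod_nonneg) auto
  have F: "F m r = (-1) ^ r / fact r * (\<Sum>x\<in>P r. c r x * \<mu> powr e x * ((e x gchoose m) * (- u) ^ m))"
    for m r
    unfolding F_def expansion_term_def P_def[symmetric] e_def[symmetric]
    by (simp add: c_def gbinomial_eq_falling_factorial sum_distrib_left sum_distrib_right
        power_minus[of u] mult_ac)
  have absF: "\<bar>F m r\<bar> \<le> 1 / fact r * (\<Sum>x\<in>P r. c r x * \<mu> powr e x * \<bar>(e x gchoose m) * (- u) ^ m\<bar>)"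
    for m r
  proof -
    have "\<bar>F m r\<bar> = 1 / fact r * \<bar>\<Sum>x\<in>P r. c r x * \<mu> powr e x * ((e x gchoose m) * (- u) ^ m)\<bar>"
      by (simp add: F abs_mult)
    also have "\<dots> \<le> 1 / fact r * (\<Sum>x\<in>P r. \<bar>c r x * \<mu> powr e x * ((e x gchoose m) * (- u) ^ m)\<bar>)"
      by (intro mult_left_mono sum_abs) auto
    finally show ?thesis using c0 by (simp add: abs_mult)
  qed
  have sm: "summable (\<lambda>m. 1 / fact r * (\<Sum>x\<in>P r. c r x * \<mu> powr e x * \<bar>(e x gchoose m) * (- u) ^ m\<bar>))" for r
    by (intro summable_mult summable_sum abs_gbinomial_series e0) (use assms in auto)
  have sF: "summable (\<lambda>m. \<bar>F m r\<bar>)" for r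
    by (rule summable_comparison_test[OF _ sm]) (use absF in auto)
  have bF: "(\<Sum>m. \<bar>F m r\<bar>) \<le> \<psi> (\<mu> / (1 - \<bar>u\<bar>)) ^ r / fact r" for r
  proof -
    have "(\<Sum>m. \<bar>F m r\<bar>) \<le> (\<Sum>m. 1 / fact r * (\<Sum>x\<in>P r. c r x * \<mu> powr e x * \<bar>(e x gchoose m) * (- u) ^ m\<bar>))"
      by (rule suminf_le[OF absF sF sm])
    also have "\<dots> = 1 / fact r * (\<Sum>x\<in>P r. c r x * \<mu> powr e x * (\<Sum>m. \<bar>(e x gchoose m) * (- u) ^ m\<bar>))"
      using assms abs_gbinomial_series(1)[OF e0, of "- u"]
      by (subst suminf_mult, force intro!: summable_sum summable_mult)
        (subst suminf_sum, auto intro!: summable_mult simp: suminf_mult)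
    also have "\<dots> \<le> 1 / fact r * (\<Sum>x\<in>P r. c r x * \<mu> powr e x * (1 - \<bar>u\<bar>) powr (- e x))"
      using assms abs_gbinomial_series(2)[OF e0, of "- u"] c0
      by (intro mult_left_mono sum_mono mult_nonneg_nonneg) auto
    also have "\<dots> = \<psi> (\<mu> / (1 - \<bar>u\<bar>)) ^ r / fact r"
      using assms by (subst multi) (auto simp: powr_divide powr_minus_divide)
    finally show ?thesis .
  qed
  have G: "(\<Sum>m. F m r) = (- \<psi> (\<mu> * (1 - u))) ^ r / fact r" for r
  proof -
    have "(\<lambda>m. F m r) sums ((-1) ^ r / fact r * (\<Sum>x\<in>P r. c r x * \<mu> powr e x * (1 - u) powr e x))"
      unfolding F using assms gen_binomial_real[of "- u"]
      by (intro sums_mult sums_sum) auto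
    also have "(-1) ^ r / fact r * (\<Sum>x\<in>P r. c r x * \<mu> powr e x * (1 - u) powr e x) =
        (- \<psi> (\<mu> * (1 - u))) ^ r / fact r"
      using assms by (simp add: multi powr_mult mult_ac power_minus[of "\<psi> _"])
    finally show ?thesis by (simp add: sums_iff)
  qed
  have sB: "summable (\<lambda>r. \<psi> (\<mu> / (1 - \<bar>u\<bar>)) ^ r / fact r)"
    using summable_exp[of "\<psi> (\<mu> / (1 - \<bar>u\<bar>))"] by (simp add: field_simps)
  note sw = sums_swap[of F, OF sF bF sB]
  have scale: "expansion_term \<mu> A a d m r = (fact m / ((-1) ^ m * u ^ m)) * F m r" for m r
    using \<open>u \<noteq> 0\<close> by (simp add: F_def)
  show s: "summable (expansion_term \<mu> A a d m)" for m
    unfolding scale[abs_def] by (intro summable_mult sw)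
  have "(\<Sum>r. F m r) = ((-1) ^ m / fact m * (\<Sum>r. expansion_term \<mu> A a d m r)) * u ^ m" for m
    unfolding F_def
    by (simp only: suminf_mult[OF s[of m]] suminf_mult2[OF summable_mult[OF s[of m]], symmetric])
  moreover have "(\<Sum>r. \<Sum>m. F m r) = exp (- \<psi> (\<mu> * (1 - u)))"
    unfolding G exp_def by (simp add: divide_inverse mult.commute)
  ultimately show "(\<lambda>m. ((-1) ^ m / fact m * (\<Sum>r. expansion_term \<mu> A a d m r)) * u ^ m)
           sums exp (- (\<Sum>i\<in>A. d i * (\<mu> * (1 - u)) powr a i))"
    using sw(2) by (simp add: \<psi>_def)
qed

text \<open>
  The coefficients are recovered one after the other as limits at \<open>0\<close>, the lower-order part
  being removed and the rest divided by the leading power.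
\<close>
lemma power_series_coeffs_unique:
  fixes p q :: "nat \<Rightarrow> real"
  assumes "0 < \<rho>"
    and "\<And>u. u \<noteq> 0 \<Longrightarrow> \<bar>u\<bar> < \<rho> \<Longrightarrow> (\<lambda>m. p m * u ^ m) sums f u"
    and "\<And>u. u \<noteq> 0 \<Longrightarrow> \<bar>u\<bar> < \<rho> \<Longrightarrow> (\<lambda>m. q m * u ^ m) sums f u"
  shows "p = q"
proof
  have diff: "(\<lambda>m. (p m - q m) * u ^ m) sums 0" if "u \<noteq> 0" "\<bar>u\<bar> < \<rho>" for u
    using sums_diff[OF assms(2,3)[OF that]] by (simp add: algebra_simps)
  show "p m = q m" for m
  proof (induction m rule: less_induct)
    case (less m)
    have "(\<lambda>i. (p (i + m) - q (i + m)) * u ^ i) sums 0" if "u \<noteq> 0" "norm u < \<rho>" for u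
    proof -
      have "(\<lambda>i. (p (i + m) - q (i + m)) * u ^ (i + m)) sums 0"
        using sums_split_initial_segment[OF diff[of u], of m] that less by simp
      from sums_divide[OF this, of "u ^ m"] show ?thesis
        using that by (simp add: power_add)
    qed
    then have "((\<lambda>u :: real. 0 :: real) \<longlongrightarrow> p (0 + m) - q (0 + m)) (at 0)"
      by (rule powser_limit_0_strong[OF assms(1), where a = "\<lambda>i. p (i + m) - q (i + m)"])
    then show "p m = q m" using tendsto_unique[OF trivial_limit_at[of "0::real"] _ tendsto_const] by fastforce
  qed
qed

section \<open>Poisson processes at independent random times\<close>

text \<open>
  The Poisson probability mass function, extended to rate \<open>0\<close>: there \<open>0 ^ 0 = 1\<close> gives the point
  mass at \<open>0\<close>.
\<close>
definition poisson_weight :: "real \<Rightarrow> nat \<Rightarrow> real" where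
  "poisson_weight x m = x ^ m / fact m * exp (- x)"

lemma poisson_weight_nonneg: "0 \<le> x \<Longrightarrow> 0 \<le> poisson_weight x m"
  by (simp add: poisson_weight_def)

lemma poisson_weight_le_1:
  assumes "0 \<le> x"
  shows "poisson_weight x m \<le> 1"
proof (cases "x = 0")
  case True
  then show ?thesis by (cases m) (auto simp: poisson_weight_def)
next
  case False
  with assms have "pmf (poisson_pmf x) m \<le> 1" by (intro pmf_le_1)
  with False assms show ?thesis by (simp add: poisson_weight_def)
qed

lemma measurable_poisson_weight [measurable]:
  "(\<lambda>x. poisson_weight x m) \<in> borel_measurable borel"
  unfolding poisson_weight_def by measurable

lemma poisson_weight_generating_function: "(\<lambda>m. poisson_weight x m * u ^ m) sums exp (- x * (1 - u))"
proof -
  have "(\<lambda>m. exp (- x) * ((x * u) ^ m /\<^sub>R fact m)) sums (exp (- x) * exp (x * u))"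
    by (intro sums_mult exp_converges)
  then show ?thesis
    by (simp add: poisson_weight_def power_mult_distrib divide_inverse mult_ac exp_add[symmetric]
        algebra_simps)
qed

text \<open>
  The generating function of a Poisson law with random parameter \<open>\<mu> * V\<close> is the Laplace transform
  of \<open>V\<close> at \<open>\<mu> * (1 - u)\<close>. As weights are at most \<open>1\<close>, the geometric series dominates and
  sum and expectation commute.
\<close>
lemma (in prob_space) poisson_mixture_generating_function:
  fixes V :: "'a \<Rightarrow> real"
  assumes [measurable]: "V \<in> borel_measurable M" and V: "AE \<omega> in M. 0 \<le> V \<omega>"
    and "0 \<le> \<mu>" "\<bar>u\<bar> < 1"
  shows "(\<lambda>m. expectation (\<lambda>\<omega>. poisson_weight (\<mu> * V \<omega>) m) * u ^ m)
           sums expectation (\<lambda>\<omega>. exp (- (\<mu> * (1 - u)) * V \<omega>))"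
proof -
  let ?f = "\<lambda>m \<omega>. poisson_weight (\<mu> * V \<omega>) m * u ^ m"
  have bnd: "AE \<omega> in M. \<forall>m. norm (?f m \<omega>) \<le> \<bar>u\<bar> ^ m"
    using V
  proof eventually_elim
    case (elim \<omega>)
    then show ?case
      using poisson_weight_nonneg[of "\<mu> * V \<omega>"] poisson_weight_le_1[of "\<mu> * V \<omega>"] \<open>0 \<le> \<mu>\<close>
      by (auto simp: abs_mult power_abs intro!: mult_left_le_one_le)
  qed
  have geo: "summable (\<lambda>m. \<bar>u\<bar> ^ m)" using \<open>\<bar>u\<bar> < 1\<close> by (intro summable_geometric) simp
  have int: "integrable M (?f m)" for m
    by (rule integrable_const_bound[where B = "\<bar>u\<bar> ^ m"]) (use bnd in auto)
  have "(\<lambda>m. expectation (?f m)) sums expectation (\<lambda>\<omega>. \<Sum>m. ?f m \<omega>)"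
  proof (rule sums_integral[OF int])
    show "AE \<omega> in M. summable (\<lambda>m. norm (?f m \<omega>))"
      using bnd by eventually_elim (rule summable_comparison_test[OF _ geo], auto)
    show "summable (\<lambda>m. \<integral>\<omega>. norm (?f m \<omega>) \<partial>M)"
    proof (rule summable_comparison_test[OF _ geo], intro exI allI impI)
      fix m
      have "(\<integral>\<omega>. norm (?f m \<omega>) \<partial>M) \<le> (\<integral>\<omega>. \<bar>u\<bar> ^ m \<partial>M)"
        by (rule integral_mono_AE) (use bnd int in auto)
      then show "norm (\<integral>\<omega>. norm (?f m \<omega>) \<partial>M) \<le> \<bar>u\<bar> ^ m"
        by (simp add: prob_space integral_nonneg_AE)
    qed
  qed
  moreover have "(\<Sum>m. ?f m \<omega>) = exp (- (\<mu> * (1 - u)) * V \<omega>)" for \<omega>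
    using sums_unique[OF poisson_weight_generating_function[of "\<mu> * V \<omega>" u]] by (simp add: mult_ac)
  ultimately show ?thesis by simp
qed

lemma (in prob_space) measurable_counting_process:
  assumes "poisson_process M \<mu> N" "0 \<le> u"
  shows "N u \<in> measurable M (count_space UNIV)"
proof -
  have [measurable]: "(\<lambda>\<omega>. real (N u \<omega>)) \<in> borel_measurable M"
    using assms unfolding poisson_process_def levy_process_def by blast
  have "(\<lambda>\<omega>. nat \<lfloor>real (N u \<omega>)\<rfloor>) \<in> measurable M (count_space UNIV)" by measurable
  then show ?thesis by simp
qed

lemma (in prob_space) prob_poisson_process_eq:
  assumes "poisson_process M \<mu> N" "0 < \<mu>" "0 < u"
  shows "prob {\<omega> \<in> space M. N u \<omega> = m} = poisson_weight (\<mu> * u) m"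
proof -
  note [measurable] = measurable_counting_process[OF assms(1)]
  have "prob {\<omega> \<in> space M. N u \<omega> = m} = measure (distr M (count_space UNIV) (N u)) {m}"
    using assms by (subst measure_distr) (auto intro!: arg_cong[where f = prob])
  also have "distr M (count_space UNIV) (N u) = measure_pmf (poisson_pmf (\<mu> * u))"
    using assms unfolding poisson_process_def by blast
  finally show ?thesis using assms by (simp add: measure_pmf_single poisson_weight_def)
qed

text \<open>
  Conditioning on the value of \<open>D\<close>. The difference of the two integrands is split along the events
  \<open>D = i\<close>; on each of them independence makes its expectation vanish.
\<close>
lemma (in prob_space) prob_poisson_at_discrete_time:
  assumes N: "poisson_process M \<mu> N" and "0 < \<mu>"
    and [measurable]: "D \<in> measurable M (count_space UNIV)" and g: "\<And>i :: nat. 0 < g i"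
    and indep: "\<And>i. indep_var borel (\<lambda>\<omega>. real (N (g i) \<omega>)) borel (\<lambda>\<omega>. real (D \<omega>))"
  shows "prob {\<omega> \<in> space M. N (g (D \<omega>)) \<omega> = m} = expectation (\<lambda>\<omega>. poisson_weight (\<mu> * g (D \<omega>)) m)"
proof -
  have [measurable]: "N (g i) \<in> measurable M (count_space UNIV)" for i
    using measurable_counting_process[OF N] g[of i] by simp
  have [measurable]: "(\<lambda>\<omega>. N (g (D \<omega>)) \<omega>) \<in> measurable M (count_space UNIV)"
    by (rule measurable_compose_countable[where f = "\<lambda>i. N (g i)"]) measurable
  let ?h = "\<lambda>i. poisson_weight (\<mu> * g i) m"
  let ?I = "\<lambda>i \<omega>. if N (g i) \<omega> = m then 1 else 0 :: real"
  let ?f = "\<lambda>i \<omega>. if D \<omega> = i then ?I i \<omega> - ?h i else 0"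
  have h: "0 \<le> ?h i" "?h i \<le> 1" for i
    using g[of i] \<open>0 < \<mu>\<close> by (auto intro!: poisson_weight_nonneg poisson_weight_le_1)
  have f1: "norm (?f i \<omega>) \<le> indicator {\<omega> \<in> space M. D \<omega> = i} \<omega>" if "\<omega> \<in> space M" for i \<omega>
    using h[of i] that by auto
  have int: "integrable M (?f i)" for i
    by (rule integrable_const_bound[where B = 1]) (use h[of i] in auto)
  have zero: "expectation (?f i) = 0" for i
  proof -
    have "expectation (?f i) = expectation (\<lambda>\<omega>. indicator {\<omega> \<in> space M. N (g i) \<omega> = m \<and> D \<omega> = i} \<omega>
        - ?h i * indicator {\<omega> \<in> space M. D \<omega> = i} \<omega>)"
      by (intro Bochner_Integration.integral_cong) auto
    also have "\<dots> = prob {\<omega> \<in> space M. N (g i) \<omega> = m \<and> D \<omega> = i} - ?h i * prob {\<omega> \<in> space M. D \<omega> = i}"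
      by (subst Bochner_Integration.integral_diff)
        (auto intro!: integrable_mult_right integrable_real_indicator simp: emeasure_eq_measure)
    also have "prob {\<omega> \<in> space M. N (g i) \<omega> = m \<and> D \<omega> = i} =
        prob {\<omega> \<in> space M. N (g i) \<omega> = m} * prob {\<omega> \<in> space M. D \<omega> = i}"
      using prob_indep_random_variable[OF indep[of i], of "{real m}" "{real i}"] by simp
    also have "prob {\<omega> \<in> space M. N (g i) \<omega> = m} = ?h i"
      by (rule prob_poisson_process_eq[OF N \<open>0 < \<mu>\<close> g])
    finally show ?thesis by simp
  qed
  have "(\<lambda>i. expectation (?f i)) sums expectation (\<lambda>\<omega>. \<Sum>i. ?f i \<omega>)"
  proof (rule sums_integral[OF int])
    show "AE \<omega> in M. summable (\<lambda>i. norm (?f i \<omega>))"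
    proof (rule AE_I2)
      fix \<omega>
      show "summable (\<lambda>i. norm (?f i \<omega>))"
        by (rule summable_finite[of "{D \<omega>}"]) auto
    qed
    have S: "summable (\<lambda>i. prob {\<omega> \<in> space M. D \<omega> = i})"
      by (rule sums_summable[OF finite_measure_UNION]) (auto simp: disjoint_family_on_def)
    show "summable (\<lambda>i. \<integral>\<omega>. norm (?f i \<omega>) \<partial>M)"
    proof (rule summable_comparison_test[OF _ S], intro exI allI impI)
      fix i
      have "(\<integral>\<omega>. norm (?f i \<omega>) \<partial>M) \<le> (\<integral>\<omega>. indicator {\<omega> \<in> space M. D \<omega> = i} \<omega> \<partial>M)"
        using int f1
        by (intro integral_mono) (auto intro!: integrable_real_indicator simp: emeasure_eq_measure)
      then show "norm (\<integral>\<omega>. norm (?f i \<omega>) \<partial>M) \<le> prob {\<omega> \<in> space M. D \<omega> = i}"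
        by (simp add: integral_nonneg_AE)
    qed
  qed
  moreover have "(\<Sum>i. ?f i \<omega>) = ?I (D \<omega>) \<omega> - ?h (D \<omega>)" for \<omega>
    using suminf_finite[of "{D \<omega>}" "\<lambda>i. ?f i \<omega>"] by auto
  ultimately have "0 = expectation (\<lambda>\<omega>. ?I (D \<omega>) \<omega> - ?h (D \<omega>))"
    using zero sums_unique by fastforce
  also have "\<dots> = expectation (\<lambda>\<omega>. indicator {\<omega> \<in> space M. N (g (D \<omega>)) \<omega> = m} \<omega> - ?h (D \<omega>))"
    by (intro Bochner_Integration.integral_cong) auto
  also have "\<dots> = prob {\<omega> \<in> space M. N (g (D \<omega>)) \<omega> = m} - expectation (\<lambda>\<omega>. ?h (D \<omega>))"
    using h by (subst Bochner_Integration.integral_diff)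
      (auto intro!: integrable_const_bound[where B = 1] simp: abs_of_nonneg)
  finally show ?thesis by simp
qed

text \<open>
  The grid of mesh \<open>1 / Suc k\<close> approximates \<open>v\<close> strictly from above, as needed to use
  right-continuity of paths. Counting grid points from \<open>1\<close> also keeps them positive.
\<close>
lemma grid_above_tendsto_at_right:
  fixes v :: real
  assumes "0 \<le> v"
  shows "filterlim (\<lambda>k. real (Suc (nat \<lfloor>real (Suc k) * v\<rfloor>)) / real (Suc k)) (at_right v) sequentially"
proof (rule tendsto_imp_filterlim_at_right)
  let ?w = "\<lambda>k. real (Suc (nat \<lfloor>real (Suc k) * v\<rfloor>)) / real (Suc k)"
  have 1: "v < ?w k" for k
  proof -
    have "real (Suc k) * v < real (Suc (nat \<lfloor>real (Suc k) * v\<rfloor>))" using assms by linarith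
    then show ?thesis by (simp add: field_simps)
  qed
  then show "\<forall>\<^sub>F k in sequentially. v < ?w k" by simp
  have 2: "?w k \<le> v + inverse (real (Suc k))" for k
  proof -
    have "0 \<le> real (Suc k) * v" using assms by simp
    then have "real (Suc (nat \<lfloor>real (Suc k) * v\<rfloor>)) \<le> real (Suc k) * v + 1" by linarith
    then have "?w k \<le> (real (Suc k) * v + 1) / real (Suc k)" by (rule divide_right_mono) simp
    also have "\<dots> = v + inverse (real (Suc k))" by (simp add: field_simps)
    finally show ?thesis .
  qed
  have "(\<lambda>k. v + inverse (real (Suc k))) \<longlonglongrightarrow> v + 0"
    by (intro tendsto_intros LIMSEQ_inverse_real_of_nat)
  then have "(\<lambda>k. v + inverse (real (Suc k))) \<longlonglongrightarrow> v" by simp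
  then show "?w \<longlonglongrightarrow> v"
    by (rule tendsto_sandwich[rotated 2, OF tendsto_const])
      (use 1 2 in \<open>auto intro!: always_eventually less_imp_le\<close>)
qed

text \<open>
  Approximate \<open>V\<close> from the right by grid-valued times \<open>W k\<close>, where the previous case applies. Paths
  of \<open>N\<close> are almost surely right-continuous and integer-valued, so \<open>N (W k)\<close> is eventually
  constant and equal to \<open>N V\<close>, and dominated convergence passes to the limit on both sides. The
  event for \<open>N V\<close> itself agrees only almost surely with the measurable limit event \<open>E\<close>, hence the
  completion.
\<close>
lemma (in prob_space) prob_poisson_at_independent_time:
  assumes N: "poisson_process M \<mu> N" and "0 < \<mu>"
    and [measurable]: "V \<in> borel_measurable M" and V: "AE \<omega> in M. 0 \<le> V \<omega>"
    and indep: "\<And>u. 0 \<le> u \<Longrightarrow> indep_var borel (\<lambda>\<omega>. real (N u \<omega>)) borel V"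
  shows "measure (completion M) {\<omega> \<in> space M. N (V \<omega>) \<omega> = m} =
    expectation (\<lambda>\<omega>. poisson_weight (\<mu> * V \<omega>) m)"
proof -
  define D where "D k \<omega> = nat \<lfloor>real (Suc k) * V \<omega>\<rfloor>" for k \<omega>
  define g where "g k i = real (Suc i) / real (Suc k)" for k i
  define W where "W k \<omega> = g k (D k \<omega>)" for k \<omega>
  have [measurable]: "D k \<in> measurable M (count_space UNIV)" for k
    unfolding D_def by measurable
  have g0: "0 < g k i" for k i by (simp add: g_def)
  have mN: "N u \<in> measurable M (count_space UNIV)" if "0 \<le> u" for u
    using measurable_counting_process[OF N that] .
  have [measurable]: "(\<lambda>\<omega>. N (W k \<omega>) \<omega>) \<in> measurable M (count_space UNIV)" for k
    unfolding W_def by (rule measurable_compose_countable[where f = "\<lambda>i. N (g k i)"])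
      (auto intro!: mN less_imp_le g0)
  have [measurable]: "W k \<in> borel_measurable M" for k
    unfolding W_def g_def by measurable
  have W0: "0 < W k \<omega>" for k \<omega> by (simp add: W_def g0)
  have grid: "prob {\<omega> \<in> space M. N (W k \<omega>) \<omega> = m} = expectation (\<lambda>\<omega>. poisson_weight (\<mu> * W k \<omega>) m)" for k
    unfolding W_def
  proof (rule prob_poisson_at_discrete_time[OF N \<open>0 < \<mu>\<close> _ g0])
    fix i
    have "indep_var borel ((\<lambda>x. x) \<circ> (\<lambda>\<omega>. real (N (g k i) \<omega>))) borel
        ((\<lambda>v. real (nat \<lfloor>real (Suc k) * v\<rfloor>)) \<circ> V)"
      by (rule indep_var_compose[OF indep]) (auto simp: less_imp_le g0)
    then show "indep_var borel (\<lambda>\<omega>. real (N (g k i) \<omega>)) borel (\<lambda>\<omega>. real (D k \<omega>))"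
      by (simp add: comp_def D_def)
  qed simp
  define E where "E = {\<omega> \<in> space M. \<exists>k. \<forall>l\<ge>k. N (W l \<omega>) \<omega> = m}"
  have [measurable]: "E \<in> sets M" unfolding E_def by measurable
  have rc: "AE \<omega> in M. \<forall>t\<ge>0. ((\<lambda>u. real (N u \<omega>)) \<longlongrightarrow> real (N t \<omega>)) (at_right t)"
    using N unfolding poisson_process_def levy_process_def by (auto elim: eventually_mono)
  have lim: "AE \<omega> in M. filterlim (\<lambda>k. W k \<omega>) (at_right (V \<omega>)) sequentially \<and>
      (\<forall>\<^sub>F k in sequentially. N (W k \<omega>) \<omega> = N (V \<omega>) \<omega>)"
    using rc V
  proof eventually_elim
    case (elim \<omega>)
    have W: "filterlim (\<lambda>k. W k \<omega>) (at_right (V \<omega>)) sequentially"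
      unfolding W_def D_def g_def by (rule grid_above_tendsto_at_right) fact
    have "(\<lambda>k. real (N (W k \<omega>) \<omega>)) \<longlonglongrightarrow> real (N (V \<omega>) \<omega>)"
      using filterlim_compose[OF _ W] elim by blast
    then have "\<forall>\<^sub>F k in sequentially. dist (real (N (W k \<omega>) \<omega>)) (real (N (V \<omega>) \<omega>)) < 1"
      by (rule tendstoD) simp
    then have "\<forall>\<^sub>F k in sequentially. N (W k \<omega>) \<omega> = N (V \<omega>) \<omega>"
      by eventually_elim (simp add: dist_real_def)
    with W show ?case by simp
  qed
  have AEE: "AE \<omega> in M. \<omega> \<in> E \<longleftrightarrow> \<omega> \<in> {\<omega> \<in> space M. N (V \<omega>) \<omega> = m}"
    using lim AE_space
  proof eventually_elim
    case (elim \<omega>)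
    then obtain k where k: "\<And>l. k \<le> l \<Longrightarrow> N (W l \<omega>) \<omega> = N (V \<omega>) \<omega>"
      by (auto simp: eventually_sequentially)
    then show ?case using elim unfolding E_def
      by simp (metis nat_le_linear)
  qed
  have "(\<lambda>k. expectation (indicator {\<omega> \<in> space M. N (W k \<omega>) \<omega> = m} :: _ \<Rightarrow> real)) \<longlonglongrightarrow>
      expectation (indicator E)"
  proof (rule integral_dominated_convergence[where w = "\<lambda>_. 1"])
    show "AE \<omega> in M. (\<lambda>k. indicator {\<omega> \<in> space M. N (W k \<omega>) \<omega> = m} \<omega> :: real) \<longlonglongrightarrow> indicator E \<omega>"
      using lim AEE AE_space
    proof eventually_elim
      case (elim \<omega>)
      then have "\<forall>\<^sub>F k in sequentially.
          (indicator {\<omega> \<in> space M. N (W k \<omega>) \<omega> = m} \<omega> :: real) = indicator E \<omega>"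
        by (auto elim!: eventually_mono simp: indicator_def)
      then show ?case by (rule tendsto_eventually)
    qed
  qed (auto simp: indicator_def)
  then have 1: "(\<lambda>k. prob {\<omega> \<in> space M. N (W k \<omega>) \<omega> = m}) \<longlonglongrightarrow> prob E"
    by simp
  have "(\<lambda>k. expectation (\<lambda>\<omega>. poisson_weight (\<mu> * W k \<omega>) m)) \<longlonglongrightarrow>
      expectation (\<lambda>\<omega>. poisson_weight (\<mu> * V \<omega>) m)"
  proof (rule integral_dominated_convergence[where w = "\<lambda>_. 1"])
    show "AE \<omega> in M. (\<lambda>k. poisson_weight (\<mu> * W k \<omega>) m) \<longlonglongrightarrow> poisson_weight (\<mu> * V \<omega>) m"
      using lim
    proof eventually_elim
      case (elim \<omega>)
      then have "(\<lambda>k. W k \<omega>) \<longlonglongrightarrow> V \<omega>"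
        by (simp add: filterlim_at)
      then show ?case unfolding poisson_weight_def by (intro tendsto_intros) auto
    qed
    show "AE \<omega> in M. norm (poisson_weight (\<mu> * W k \<omega>) m) \<le> 1" for k
      using W0[of k] \<open>0 < \<mu>\<close>
      by (intro AE_I2) (simp add: abs_of_nonneg poisson_weight_nonneg poisson_weight_le_1 less_imp_le)
  qed auto
  with 1 have eq: "prob E = expectation (\<lambda>\<omega>. poisson_weight (\<mu> * V \<omega>) m)"
    unfolding grid by (rule LIMSEQ_unique)
  have AEC: "AE \<omega> in completion M. \<omega> \<in> E \<longleftrightarrow> \<omega> \<in> {\<omega> \<in> space M. N (V \<omega>) \<omega> = m}"
    using AE_completion[OF AEE] .
  have EC: "E \<in> sets (completion M)" by simp
  have "{\<omega> \<in> space M. N (V \<omega>) \<omega> = m} \<in> sets (completion M)"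
    by (rule completion.in_sets_AE[OF AEC EC]) auto
  then have "measure (completion M) {\<omega> \<in> space M. N (V \<omega>) \<omega> = m} = measure (completion M) E"
    using AEC EC by (intro measure_eq_AE) auto
  also have "\<dots> = prob E" by simp
  finally show ?thesis using eq by simp
qed

section \<open>The law of a variable-order stable subordinator\<close>

lemma (in prob_space) laplace_sum_independent_subordinators:
  assumes S: "independent_stable_subordinators M K \<beta> S"
    and J: "finite J" "\<And>j. j \<in> J \<Longrightarrow> enat j < K" and l: "\<And>j. j \<in> J \<Longrightarrow> 0 \<le> l j"
    and w: "0 \<le> w"
  shows "expectation (\<lambda>\<omega>. exp (- w * (\<Sum>j\<in>J. S j (l j) \<omega>))) = exp (- (\<Sum>j\<in>J. l j * w powr \<beta> j))"
proof -
  have ind: "indep_vars (\<lambda>_. \<Pi>\<^sub>M t\<in>{0..}. borel) (\<lambda>j. whole_path (S j)) J"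
    using S J(2) unfolding independent_stable_subordinators_def
    by (auto intro: indep_vars_subset)
  have "indep_vars (\<lambda>_. borel) (\<lambda>j \<omega>. exp (- w * whole_path (S j) \<omega> (l j))) J"
    by (rule indep_vars_compose2[OF ind, where Y = "\<lambda>j f. exp (- w * f (l j))"])
      (use l in \<open>auto intro!: borel_measurable_exp borel_measurable_times measurable_component_singleton\<close>)
  then have ind': "indep_vars (\<lambda>_. borel) (\<lambda>j \<omega>. exp (- w * S j (l j) \<omega>)) J"
    by (rule indep_vars_cong[THEN iffD1, rotated -1]) (use l in \<open>auto simp: whole_path_def\<close>)
  have lap: "expectation (\<lambda>\<omega>. exp (- w * S j (l j) \<omega>)) = exp (- l j * w powr \<beta> j)" if "j \<in> J" for j
    using S J(2)[OF that] l[OF that] w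
    unfolding independent_stable_subordinators_def stable_subordinator_def by blast
  have int: "integrable M (\<lambda>\<omega>. exp (- w * S j (l j) \<omega>))" if "j \<in> J" for j
    using lap[OF that] not_integrable_integral_eq by fastforce
  have "expectation (\<lambda>\<omega>. exp (- w * (\<Sum>j\<in>J. S j (l j) \<omega>))) =
      expectation (\<lambda>\<omega>. \<Prod>j\<in>J. exp (- w * S j (l j) \<omega>))"
    by (simp add: sum_distrib_left exp_sum J)
  also have "\<dots> = (\<Prod>j\<in>J. expectation (\<lambda>\<omega>. exp (- w * S j (l j) \<omega>)))"
    using J int by (intro indep_vars_lebesgue_integral[OF _ ind']) auto
  also have "\<dots> = (\<Prod>j\<in>J. exp (- l j * w powr \<beta> j))"
    by (intro prod.cong refl lap)
  also have "\<dots> = exp (- (\<Sum>j\<in>J. l j * w powr \<beta> j))"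
    using J by (simp add: exp_sum sum_negf[symmetric])
  finally show ?thesis .
qed

lemma stable_subordinator_nonneg:
  assumes "stable_subordinator M a S" "0 \<le> t"
  shows "AE \<omega> in M. 0 \<le> S t \<omega>"
proof -
  have "AE \<omega> in M. S 0 \<omega> = 0" "AE \<omega> in M. mono_on {0..} (\<lambda>t. S t \<omega>)"
    using assms unfolding stable_subordinator_def levy_process_def by auto
  then show ?thesis
  proof eventually_elim
    case (elim \<omega>)
    then show ?case using mono_onD[of "{0..}" "\<lambda>t. S t \<omega>" 0 t] assms(2) by simp
  qed
qed

lemma breakpoints_mono:
  assumes "breakpoints K s" "i \<le> j" "enat j < K"
  shows "s i \<le> s j"
  using assms(2,3)
proof (induction j rule: dec_induct)
  case (step j)
  have "enat j < K" using step.prems by (meson enat_ord_simps(2) lessI less_trans)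
  with step assms(1) show ?case unfolding breakpoints_def by force
qed simp

text \<open>
  The piece containing \<open>t\<close> is the last one that starts at or before \<open>t\<close>. There are only finitely
  many candidates, because breakpoints of an infinite sequence tend to infinity.
\<close>
lemma piece_index:
  assumes K: "breakpoints K s" and "0 \<le> t"
  shows "enat (piece_index K s t) < K" and "t \<in> piece K s (piece_index K s t)"
proof -
  let ?A = "{k. enat k < K \<and> s k \<le> t}"
  have fin: "finite ?A"
  proof (cases K)
    case (enat k)
    then show ?thesis by (intro finite_subset[of ?A "{..<k}"]) auto
  next
    case infinity
    then have "\<forall>\<^sub>F k in sequentially. t < s k"
      using K unfolding breakpoints_def filterlim_at_top_dense by blast
    then obtain k where "\<And>l. k \<le> l \<Longrightarrow> t < s l" by (auto simp: eventually_sequentially)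
    then show ?thesis
      by (intro finite_subset[of ?A "{..k}"]) (auto, meson nat_le_linear not_less)
  qed
  have "0 \<in> ?A" using assms by (simp add: breakpoints_def zero_enat_def)
  then have max: "Max ?A \<in> ?A" using Max_in[OF fin] by blast
  have ge: "k \<le> Max ?A" if "enat k < K" "s k \<le> t" for k using Max_ge[OF fin] that by blast
  have ex: "enat (Max ?A) < K \<and> t \<in> piece K s (Max ?A)"
    using max ge[of "Suc (Max ?A)"] by (auto simp: piece_def not_le[symmetric])
  have uniq: "i = Max ?A" if "enat i < K \<and> t \<in> piece K s i" for i
  proof (rule ccontr)
    assume "i \<noteq> Max ?A"
    moreover have "s i \<le> t" using that by (auto simp: piece_def split: if_splits)
    ultimately have i: "Suc i \<le> Max ?A" using ge[of i] that by auto
    then have "enat (Suc i) \<le> enat (Max ?A)" by (simp only: enat_ord_simps)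
    also have "\<dots> < K" using max by simp
    finally have "t < s (Suc i)" using that by (simp add: piece_def)
    also have "s (Suc i) \<le> s (Max ?A)" using breakpoints_mono[OF K i] max by simp
    also have "\<dots> \<le> t" using max by simp
    finally show False by simp
  qed
  have "enat (piece_index K s t) < K \<and> t \<in> piece K s (piece_index K s t)"
    unfolding piece_index_def by (rule theI, rule ex, rule uniq)
  then show "enat (piece_index K s t) < K" "t \<in> piece K s (piece_index K s t)" by auto
qed

lemma has_integral_step_function:
  fixes f :: "real \<Rightarrow> real"
  assumes "\<And>i. i < n \<Longrightarrow> p i \<le> p (Suc i)"
    and "\<And>i u. i < n \<Longrightarrow> p i \<le> u \<Longrightarrow> u < p (Suc i) \<Longrightarrow> f u = c i"
  shows "(f has_integral (\<Sum>i<n. (p (Suc i) - p i) * c i)) {p 0..p n}"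
  using assms
proof (induction n)
  case 0
  then show ?case by (simp add: has_integral_refl)
next
  case (Suc n)
  have "p 0 \<le> p j" if "j \<le> n" for j
    using that
  proof (induction j)
    case (Suc j)
    with Suc.prems show ?case using \<open>\<And>i. i < Suc n \<Longrightarrow> p i \<le> p (Suc i)\<close>[of j] by simp
  qed simp
  then have "p 0 \<le> p n" by simp
  moreover have "(f has_integral (p (Suc n) - p n) * c n) {p n..p (Suc n)}"
    by (rule has_integral_spike_finite[of "{p (Suc n)}" _ _ "\<lambda>_. c n"])
      (use Suc.prems has_integral_const_real[of "c n" "p n" "p (Suc n)"] in \<open>auto simp: not_le\<close>)
  ultimately show ?case
    using Suc.IH Suc.prems has_integral_combine[of "p 0" "p n" "p (Suc n)"] by auto
qed

text \<open>
  At a fixed time the process is a sum of independent subordinators, the \<open>j\<close>-th run for the time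
  \<open>l j\<close> that \<open>{0..t}\<close> spends in piece \<open>j\<close>. The sum of the exponents is stated as an integral over
  \<open>{0..t}\<close>, which does not depend on the way the interval is cut into pieces.
\<close>
lemma (in prob_space) voss_decomposition:
  assumes S: "independent_stable_subordinators M K \<beta> S"
    and \<alpha>: "piecewise_constant_index \<alpha> K s \<beta>" and "0 \<le> t"
  obtains k l where "\<forall>j\<in>{..k}. enat j < K \<and> 0 \<le> l j"
    and "voss K s S t = (\<lambda>\<omega>. \<Sum>j\<in>{..k}. S j (l j) \<omega>)"
    and "\<forall>w. ((\<lambda>u. w powr \<alpha> u) has_integral (\<Sum>j\<in>{..k}. l j * w powr \<beta> j)) {0..t}"
proof -
  have K: "breakpoints K s" using \<alpha> by (simp add: piecewise_constant_index_def)
  define k where "k = piece_index K s t"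
  have k: "enat k < K" "t \<in> piece K s k"
    unfolding k_def using piece_index[OF K \<open>0 \<le> t\<close>] by auto
  \<comment> \<open>The breakpoints up to \<open>t\<close>, with \<open>t\<close> itself as the last one.\<close>
  define p where "p j = (if j \<le> k then s j else t)" for j
  define l where "l j = p (Suc j) - p j" for j
  have lt: "enat j < K" if "j \<le> k" for j
    using that k(1) by (meson enat_ord_simps(1) le_less_trans)
  have sk: "s k \<le> t" using k(2) by (auto simp: piece_def split: if_splits)
  have p_mono: "p j \<le> p (Suc j)" if "j < Suc k" for j
    using that sk breakpoints_mono[OF K, of j "Suc j"] lt[of "Suc j"]
    by (cases "j = k") (auto simp: p_def)
  show thesis
  proof
    show "\<forall>j\<in>{..k}. enat j < K \<and> 0 \<le> l j"
      using lt p_mono by (auto simp: l_def less_Suc_eq_le)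
    have "(\<Sum>j<k. S j (s (Suc j) - s j) \<omega>) = (\<Sum>j<k. S j (l j) \<omega>)" for \<omega>
      by (intro sum.cong) (auto simp: l_def p_def)
    moreover have "l k = t - s k" by (simp add: l_def p_def)
    ultimately show "voss K s S t = (\<lambda>\<omega>. \<Sum>j\<in>{..k}. S j (l j) \<omega>)"
      by (auto simp: voss_def k_def[symmetric] Let_def lessThan_Suc_atMost[symmetric])
    show "\<forall>w. ((\<lambda>u. w powr \<alpha> u) has_integral (\<Sum>j\<in>{..k}. l j * w powr \<beta> j)) {0..t}"
    proof
      fix w
      have "((\<lambda>u. w powr \<alpha> u) has_integral (\<Sum>j<Suc k. (p (Suc j) - p j) * w powr \<beta> j)) {p 0..p (Suc k)}"
      proof (rule has_integral_step_function)
        show "p j \<le> p (Suc j)" if "j < Suc k" for j by (rule p_mono[OF that])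
      next
        fix j u assume j: "j < Suc k" and u: "p j \<le> u" "u < p (Suc j)"
        have "u \<in> piece K s j"
        proof (cases "j = k")
          case True
          with u k(2) show ?thesis by (auto simp: p_def piece_def split: if_splits)
        next
          case False
          with j u lt[of "Suc j"] show ?thesis by (auto simp: p_def piece_def)
        qed
        then show "w powr \<alpha> u = w powr \<beta> j"
          using \<alpha> lt[of j] j by (simp add: piecewise_constant_index_def)
      qed
      moreover have "p 0 = 0" "p (Suc k) = t" using K by (auto simp: p_def breakpoints_def)
      ultimately show "((\<lambda>u. w powr \<alpha> u) has_integral (\<Sum>j\<in>{..k}. l j * w powr \<beta> j)) {0..t}"
        by (simp add: l_def lessThan_Suc_atMost)
    qed
  qed
qed

lemma (in prob_space) voss_laplace_transform:
  assumes S: "independent_stable_subordinators M K \<beta> S"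
    and \<alpha>: "piecewise_constant_index \<alpha> K s \<beta>" and "0 \<le> t"
  shows "voss K s S t \<in> borel_measurable M" and "AE \<omega> in M. 0 \<le> voss K s S t \<omega>"
    and "0 \<le> w \<Longrightarrow> expectation (\<lambda>\<omega>. exp (- w * voss K s S t \<omega>)) =
      exp (- integral {0..t} (\<lambda>u. w powr \<alpha> u))"
proof -
  obtain k l where l: "\<forall>j\<in>{..k}. enat j < K \<and> 0 \<le> l j"
      and V: "voss K s S t = (\<lambda>\<omega>. \<Sum>j\<in>{..k}. S j (l j) \<omega>)"
      and int: "\<forall>w. ((\<lambda>u. w powr \<alpha> u) has_integral (\<Sum>j\<in>{..k}. l j * w powr \<beta> j)) {0..t}"
    by (rule voss_decomposition[OF assms])
  have sub: "stable_subordinator M (\<beta> j) (S j)" if "j \<in> {..k}" for j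
    using S l that by (auto simp: independent_stable_subordinators_def)
  have m: "S j (l j) \<in> borel_measurable M" if "j \<in> {..k}" for j
    using sub[OF that] l that by (auto simp: stable_subordinator_def levy_process_def)
  show "voss K s S t \<in> borel_measurable M"
    unfolding V using m by (intro borel_measurable_sum) auto
  have "AE \<omega> in M. \<forall>j\<in>{..k}. 0 \<le> S j (l j) \<omega>"
    using stable_subordinator_nonneg[OF sub] l by (intro AE_finite_allI) auto
  then show "AE \<omega> in M. 0 \<le> voss K s S t \<omega>"
    by eventually_elim (auto simp: V intro: sum_nonneg)
  show "expectation (\<lambda>\<omega>. exp (- w * voss K s S t \<omega>)) =
      exp (- integral {0..t} (\<lambda>u. w powr \<alpha> u))" if "0 \<le> w"
    unfolding V integral_unique[OF int[rule_format, of w]]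
    using l that by (intro laplace_sum_independent_subordinators[OF S]) auto
qed

section \<open>The law of the time-changed Poisson process\<close>

theorem theorem3p2:
  fixes M :: "'a measure"
    and rate :: real
    and \<alpha> :: "real \<Rightarrow> real"
    and K :: enat and s :: "nat \<Rightarrow> real" and \<beta> :: "nat \<Rightarrow> real"
    and S :: "nat \<Rightarrow> real \<Rightarrow> 'a \<Rightarrow> real"
    and N :: "real \<Rightarrow> 'a \<Rightarrow> nat"
    and t :: real
    and n :: nat and \<tau> :: "nat \<Rightarrow> real" and a :: "nat \<Rightarrow> real"
    and m :: nat
  assumes "prob_space M"
    and "0 < rate"
    and "piecewise_constant_index \<alpha> K s \<beta>"
    and "independent_stable_subordinators M K \<beta> S"
    and "poisson_process M rate N"
    and "prob_space.indep_var M
           (\<Pi>\<^sub>M u\<in>{0..}. borel) (whole_path (\<lambda>u \<omega>. real (N u \<omega>)))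
           (\<Pi>\<^sub>M u\<in>{0..}. borel) (whole_path (voss K s S))"
    and "0 < t"
    and "\<tau> 0 = 0" and "\<tau> n = t"
    and "\<And>k. k \<in> {1..n} \<Longrightarrow> \<tau> (k - 1) < \<tau> k"
    and "\<And>k. k \<in> {1..n} \<Longrightarrow> 0 < a k \<and> a k < 1"
    and "\<And>k u. k \<in> {1..n} \<Longrightarrow> u \<in> {\<tau> (k - 1)..<\<tau> k} \<Longrightarrow> \<alpha> u = a k"
  shows
    "let T = (\<lambda>r. (-1) ^ r / fact r *
               (\<Sum>x | x \<in> {1..n} \<rightarrow>\<^sub>E (UNIV :: nat set) \<and> (\<Sum>i=1..n. x i) = r.
                  fact r / (\<Prod>i=1..n. fact (x i)) *
                  rate powr (\<Sum>i=1..n. a i * real (x i)) *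
                  falling_factorial (\<Sum>i=1..n. a i * real (x i)) m *
                  (\<Prod>k=1..n. (\<tau> k - \<tau> (k - 1)) ^ x k)))
     in summable T \<and>
        measure (completion M) {\<omega> \<in> space M. space_fractional_poisson_voss N K s S t \<omega> = m}
          = (-1) ^ m / fact m * (\<Sum>r. T r)"
proof -
  interpret prob_space M by fact
  define V where "V = voss K s S t"
  define d where "d k = \<tau> k - \<tau> (k - 1)" for k
  define q where "q m = expectation (\<lambda>\<omega>. poisson_weight (rate * V \<omega>) m)" for m
  let ?T = "expansion_term rate {1..n} a d"
  note voss = voss_laplace_transform[OF assms(4,3) less_imp_le[OF assms(7)], folded V_def]
  have integral: "integral {0..t} (\<lambda>u. w powr \<alpha> u) = (\<Sum>i=1..n. d i * w powr a i)" for w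
  proof -
    have "((\<lambda>u. w powr \<alpha> u) has_integral (\<Sum>i<n. (\<tau> (Suc i) - \<tau> i) * w powr a (Suc i))) {\<tau> 0..\<tau> n}"
    proof (rule has_integral_step_function)
      show "\<tau> i \<le> \<tau> (Suc i)" if "i < n" for i using assms(10)[of "Suc i"] that by simp
      show "w powr \<alpha> u = w powr a (Suc i)" if "i < n" "\<tau> i \<le> u" "u < \<tau> (Suc i)" for i u
        using assms(12)[of "Suc i" u] that by simp
    qed
    moreover have "(\<Sum>i<n. (\<tau> (Suc i) - \<tau> i) * w powr a (Suc i)) = (\<Sum>i=1..n. d i * w powr a i)"
      by (simp add: sum.atLeast1_atMost_eq d_def)
    ultimately show ?thesis using assms(8,9) by (simp add: integral_unique)
  qed
  have gf_q: "(\<lambda>m. q m * u ^ m) sums exp (- (\<Sum>i=1..n. d i * (rate * (1 - u)) powr a i))"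
    if "\<bar>u\<bar> < 1" for u
    using poisson_mixture_generating_function[OF voss(1,2), of rate u] voss(3)[of "rate * (1 - u)"] that assms(2)
    by (simp add: q_def integral)
  have a0: "0 \<le> a i" "0 \<le> d i" if "i \<in> {1..n}" for i
    using assms(10,11)[OF that] by (auto simp: d_def)
  note expansion = exp_series_expansion[of "{1..n}" rate a d, OF finite_atLeastAtMost assms(2) a0]
  have "q = (\<lambda>m. (-1) ^ m / fact m * (\<Sum>r. ?T m r))"
    by (rule power_series_coeffs_unique[OF zero_less_one gf_q expansion(2)])
  then have q: "q m = (-1) ^ m / fact m * (\<Sum>r. ?T m r)" by metis
  have "indep_var borel (\<lambda>\<omega>. real (N u \<omega>)) borel V" if "0 \<le> u" for u
  proof -
    have "indep_var borel ((\<lambda>f. f u) \<circ> whole_path (\<lambda>u \<omega>. real (N u \<omega>)))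
        borel ((\<lambda>f. f t) \<circ> whole_path (voss K s S))"
      using that assms(7)
      by (intro indep_var_compose[OF assms(6)] measurable_component_singleton) auto
    then show ?thesis using that assms(7) by (simp add: comp_def whole_path_def V_def)
  qed
  then have "measure (completion M) {\<omega> \<in> space M. N (V \<omega>) \<omega> = m} = q m"
    unfolding q_def by (intro prob_poisson_at_independent_time[OF assms(5,2) voss(1,2)])
  \<comment> \<open>Any nonzero argument in the unit interval serves here.\<close>
  moreover have "summable (?T m)" using expansion(1)[of "1/2"] by simp
  ultimately show ?thesis
    unfolding Let_def space_fractional_poisson_voss_def V_def[symmetric]
    using q by (simp add: expansion_term_def[abs_def] d_def)
qed

end
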